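(* Let $\lambda$ be a fixed nonzero real number, and let $S_{f,\lambda}(n,k,H)$ be the degenerate generalized Stirling operators of the first kind associated with the generalized Heisenberg algebra $\mathrm{GHA}_f$, i.e. the coefficients in $(a^{\dagger})^{n}a^{n}=\sum_{k=0}^{n}S_{f,\lambda}(n,k,H)(a^{\dagger}a)_{k,\lambda}$ for $n\ge 0$. For any integers $n,k$ with $n\ge k\ge 0$, $$S_{f,\lambda}(n+1,k,H)=S_{f,\lambda}(n,k-1,H)+\big(k\lambda-(n)_{f}(H)\big)S_{f,\lambda}(n,k,H),$$ where $(n)_f(H)=H-f^{-n}(H)$ and $S_{f,\lambda}(n,-1,H)=0$.
   Context: The generalized Heisenberg algebra $\mathrm{GHA}_f$ is the algebra generated by $\{a,a^{\dagger},H\}$ (together with functions of $H$) subject to the relations $$aH=f(H)a,\qquad Ha^{\dagger}=a^{\dagger}f(H),\qquad [a,a^{\dagger}]=aa^{\dagger}-a^{\dagger}a=f(H)-H,$$ where $H$ is the self-conjugate Hamiltonian and $f(H)$ is an analytic function of $H$; $f$ is assumed to have a compositional inverse $f^{-1}$. Functions of $H$ commute with each other, and the first two relations extend to functions $g$ of $H$: $a\,g(H)=g(f(H))\,a$ and $g(H)\,a^{\dagger}=a^{\dagger}g(f(H))$. For a positive integer $k$, $f^{k}$ is the $k$-fold composition of $f$, $f^{-k}$ is the $k$-fold composition of $f^{-1}$, and $f^{0}$ is the identity. For $k\in\mathbb{Z}$, $(k)_f(H)=H-f^{-k}(H)$. Degenerate falling factorials: $(x)_{0,\lambda}=1$ and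 $(x)_{n,\lambda}=x(x-\lambda)(x-2\lambda)\cdots(x-(n-1)\lambda)$ for $n\ge 1$. The degenerate generalized Stirling operators of the first kind $S_{f,\lambda}(n,k,H)$ are the functions of $H$ defined by $$(a^{\dagger})^{n}a^{n}=\sum_{k=0}^{n}S_{f,\lambda}(n,k,H)\,(a^{\dagger}a)_{k,\lambda}\qquad(n\ge 0),$$ with $S_{f,\lambda}(n,k,H)=0$ if $k>n$ or $k<0$. The coefficients (functions of $H$, written on the left) in such expansions in the elements $(a^{\dagger}a)_{k,\lambda}$ are understood to be uniquely determined, i.e. the powers of $a^{\dagger}a$ are linearly independent over the functions of $H$. *)

theory Defs
  imports "HOL-Analysis.Analysis" "HOL-Library.Poly_Mapping"
begin

text \<open>
  The algebra \<open>GHA\<^sub>f\<close> is given by its presentation: the free complex algebra on the letters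
  \<open>a\<close>, \<open>a\<^sup>\<dagger>\<close> and \<open>g(H)\<close>, one letter for every function \<open>g\<close>, modulo a two-sided ideal.
  Since the ideal depends on \<open>f\<close>, the quotient is not a type; identities in \<open>GHA\<^sub>f\<close> are
  congruences modulo that ideal.

  The set \<open>D\<close> is the range of values of the self-conjugate \<open>H\<close>, so it consists of real numbers
  in the theorem; it is invariant under \<open>f\<close> and its inverse, and functions of \<open>H\<close> are the
  complex-valued functions on \<open>D\<close>.
\<close>

datatype letter = Ann | Cre | Fn "complex \<Rightarrow> complex"

text \<open>
  The free monoid, written additively because \<^theory>\<open>HOL-Library.Poly_Mapping\<close> builds the
  monoid algebra over an additive (here noncommutative) monoid.
\<close>

datatype word = Word (letters: "letter list")

instantiation word :: monoid_add
begin

definition zero_word :: word where "0 = Word []"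

definition plus_word :: "word \<Rightarrow> word \<Rightarrow> word" where
  "u + v = Word (letters u @ letters v)"

instance
  by standard (auto simp: zero_word_def plus_word_def)

end

type_synonym free_alg = "word \<Rightarrow>\<^sub>0 complex"

definition gen :: "letter \<Rightarrow> free_alg" where
  "gen l = Poly_Mapping.single (Word [l]) 1"

definition scal :: "complex \<Rightarrow> free_alg" where
  "scal c = Poly_Mapping.single 0 c"

definition ann :: free_alg where "ann = gen Ann"

definition cre :: free_alg where "cre = gen Cre"

definition fn :: "(complex \<Rightarrow> complex) \<Rightarrow> free_alg" where "fn g = gen (Fn g)"

definition ham :: free_alg where "ham = fn (\<lambda>z. z)"

definition fn_rels :: "complex set \<Rightarrow> free_alg set" where
  "fn_rels D =
     {fn g - fn h | g h. \<forall>z\<in>D. g z = h z} \<union>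
     {fn (\<lambda>_. c) - scal c | c. True} \<union>
     {fn (\<lambda>z. g z + h z) - (fn g + fn h) | g h. True} \<union>
     {fn (\<lambda>z. g z * h z) - fn g * fn h | g h. True}"

text \<open>
  The relations \<open>aH = f(H)a\<close> and \<open>Ha\<^sup>\<dagger> = a\<^sup>\<dagger>f(H)\<close> are the case \<open>g(H) = H\<close> of the first two families.
\<close>

definition gha_rels :: "(complex \<Rightarrow> complex) \<Rightarrow> free_alg set" where
  "gha_rels f =
     {ann * fn g - fn (\<lambda>z. g (f z)) * ann | g. True} \<union>
     {fn g * cre - cre * fn (\<lambda>z. g (f z)) | g. True} \<union>
     {(ann * cre - cre * ann) - (fn f - ham)}"

inductive_set gha_ideal :: "complex set \<Rightarrow> (complex \<Rightarrow> complex) \<Rightarrow> free_alg set"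
  for D f where
  zero: "0 \<in> gha_ideal D f"
| rel: "r \<in> fn_rels D \<union> gha_rels f \<Longrightarrow> x * r * y \<in> gha_ideal D f"
| add: "p \<in> gha_ideal D f \<Longrightarrow> q \<in> gha_ideal D f \<Longrightarrow> p + q \<in> gha_ideal D f"

definition gha_eq :: "complex set \<Rightarrow> (complex \<Rightarrow> complex) \<Rightarrow> free_alg \<Rightarrow> free_alg \<Rightarrow> bool" where
  "gha_eq D f p q \<longleftrightarrow> p - q \<in> gha_ideal D f"

definition comp_pow ::
  "complex set \<Rightarrow> (complex \<Rightarrow> complex) \<Rightarrow> int \<Rightarrow> complex \<Rightarrow> complex" where
  "comp_pow D f k = (if 0 \<le> k then f ^^ nat k else inv_into D f ^^ nat (- k))"

definition f_num ::
  "complex set \<Rightarrow> (complex \<Rightarrow> complex) \<Rightarrow> int \<Rightarrow> complex \<Rightarrow> complex" where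
  "f_num D f k z = z - comp_pow D f (- k) z"

primrec deg_falling :: "real \<Rightarrow> free_alg \<Rightarrow> nat \<Rightarrow> free_alg" where
  "deg_falling lam x 0 = 1"
| "deg_falling lam x (Suc n) = deg_falling lam x n * (x - scal (of_nat n * of_real lam))"

text \<open>
  Values off \<open>D\<close> are not seen by \<open>g(H)\<close>; fixing them to be \<open>0\<close> makes the representative of each
  coefficient unique.
\<close>

definition deg_stirling1 ::
  "complex set \<Rightarrow> (complex \<Rightarrow> complex) \<Rightarrow> real \<Rightarrow> nat \<Rightarrow> int \<Rightarrow> complex \<Rightarrow> complex" where
  "deg_stirling1 D f lam n = (THE S.
     gha_eq D f (cre ^ n * ann ^ n)
       (\<Sum>k=0..n. fn (S (int k)) * deg_falling lam (cre * ann) k) \<and>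
     (\<forall>k. k < 0 \<or> k > int n \<longrightarrow> S k = (\<lambda>_. 0)) \<and>
     (\<forall>k. \<forall>z. z \<notin> D \<longrightarrow> S k z = 0))"

end

theory Submission
  imports Defs
begin

text \<open>
  Write \<open>N = a\<^sup>\<dagger>a\<close> and \<open>X\<^sub>n = (a\<^sup>\<dagger>)\<^sup>n a\<^sup>n\<close>. The relations say that \<open>aa\<^sup>\<dagger> = N + f(H) - H\<close>, and therefore
  \<open>aN = (N + f(H) - H)a\<close> and \<open>aH = f(H)a\<close>: the element \<open>N - H\<close> commutes with \<open>a\<close>. Inserting
  \<open>N = (N - H) + H\<close> into the middle of \<open>X\<^sub>n\<^sub>+\<^sub>1 = (a\<^sup>\<dagger>)\<^sup>n N a\<^sup>n\<close>, moving \<open>N - H\<close> to the right and \<open>H\<close> to the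
  left through \<open>(a\<^sup>\<dagger>)\<^sup>n\<close>, gives
  \<open>X\<^sub>n\<^sub>+\<^sub>1 = X\<^sub>n (N - H) + f\<^sup>-\<^sup>n(H) X\<^sub>n\<close> (\<open>normal_power_Suc\<close>). Since \<open>N\<close> commutes with the functions of
  \<open>H\<close>, and \<open>(N)\<^sub>k N = (N)\<^sub>k\<^sub>+\<^sub>1 + k\<lambda> (N)\<^sub>k\<close> for the degenerate falling factorials, the
  functions given by the claimed recurrence are coefficients of an expansion of \<open>X\<^sub>n\<close>
  (\<open>coef_expansion\<close>).

  The Stirling operators are defined by a definite description, so it has to be shown as well
  that the coefficients of such an expansion are determined on \<open>D\<close>. For every complex number \<open>c\<close>
  the algebra acts on functions \<open>\<phi>\<close> on \<open>D\<close> by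
  \<open>(a\<phi>)(z) = \<phi>(f(z))\<close>, \<open>(a\<^sup>\<dagger>\<phi>)(z) = (c + z) \<phi>(f\<^sup>-\<^sup>1(z))\<close> and \<open>(g(H)\<phi>)(z) = g(z) \<phi>(z)\<close>. There \<open>N\<close> is
  multiplication by \<open>c + z\<close>, so at a fixed \<open>z\<close> in \<open>D\<close> the two sides of an identity between expansions
  become values of two polynomials at the arbitrary number \<open>c + z\<close>, written in the basis of
  degenerate falling factorials. Comparing coefficients gives uniqueness (\<open>expansion_unique\<close>).
\<close>

section \<open>Calculating modulo the defining ideal\<close>

locale gha =
  fixes D :: "complex set" and f :: "complex \<Rightarrow> complex"
  assumes bij: "bij_betw f D D"
begin

abbreviation eq_gha :: "free_alg \<Rightarrow> free_alg \<Rightarrow> bool" (infix "\<doteq>" 50) where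
  "p \<doteq> q \<equiv> gha_eq D f p q"

abbreviation finv :: "complex \<Rightarrow> complex" where "finv \<equiv> inv_into D f"

abbreviation num :: free_alg where "num \<equiv> cre * ann"

lemma f_in: "z \<in> D \<Longrightarrow> f z \<in> D"
  using bij by (auto simp: bij_betw_def)

lemma finv_in: "z \<in> D \<Longrightarrow> finv z \<in> D"
  using bij by (metis bij_betw_imp_surj_on inv_into_into)

lemma f_finv: "z \<in> D \<Longrightarrow> f (finv z) = z"
  using bij by (metis bij_betw_imp_surj_on f_inv_into_f)

lemma finv_f: "z \<in> D \<Longrightarrow> finv (f z) = z"
  using bij by (simp add: bij_betw_def)

lemma ideal_mult: "p \<in> gha_ideal D f \<Longrightarrow> x * p * y \<in> gha_ideal D f"
proof (induction rule: gha_ideal.induct)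
  case zero
  show ?case by (simp add: gha_ideal.zero)
next
  case (rel r u v)
  have "x * (u * r * v) * y = (x * u) * r * (v * y)" by (simp add: mult.assoc)
  then show ?case using gha_ideal.rel[OF rel, of "x * u" "v * y"] by simp
next
  case (add p q)
  then show ?case by (simp add: distrib_left distrib_right gha_ideal.add)
qed

lemma ideal_uminus: "p \<in> gha_ideal D f \<Longrightarrow> - p \<in> gha_ideal D f"
  using ideal_mult[of p "-1" 1] by simp

lemma eq_refl [simp, intro]: "p \<doteq> p"
  by (simp add: gha_eq_def gha_ideal.zero)

lemma eq_sym: "p \<doteq> q \<Longrightarrow> q \<doteq> p"
  using ideal_uminus[of "p - q"] by (simp add: gha_eq_def)

lemma eq_trans [trans]: "p \<doteq> q \<Longrightarrow> q \<doteq> r \<Longrightarrow> p \<doteq> r"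
  using gha_ideal.add[of "p - q" D f "q - r"] by (simp add: gha_eq_def)

lemma eq_add: "p \<doteq> p' \<Longrightarrow> q \<doteq> q' \<Longrightarrow> p + q \<doteq> p' + q'"
  using gha_ideal.add[of "p - p'" D f "q - q'"] by (simp add: gha_eq_def algebra_simps)

lemma eq_uminus: "p \<doteq> p' \<Longrightarrow> - p \<doteq> - p'"
  using ideal_uminus[of "p - p'"] by (simp add: gha_eq_def)

lemma eq_diff: "p \<doteq> p' \<Longrightarrow> q \<doteq> q' \<Longrightarrow> p - q \<doteq> p' - q'"
  using eq_add[OF _ eq_uminus] by (metis add_uminus_conv_diff)

lemma eq_mult: "p \<doteq> p' \<Longrightarrow> q \<doteq> q' \<Longrightarrow> p * q \<doteq> p' * q'"
proof -
  assume "p \<doteq> p'" "q \<doteq> q'"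
  then have "1 * (p - p') * q + p' * (q - q') * 1 \<in> gha_ideal D f"
    unfolding gha_eq_def by (intro gha_ideal.add ideal_mult)
  then show ?thesis by (simp add: gha_eq_def algebra_simps)
qed

lemma eq_sum: "(\<And>i. i \<in> A \<Longrightarrow> p i \<doteq> q i) \<Longrightarrow> sum p A \<doteq> sum q A"
  by (induction A rule: infinite_finite_induct) (auto intro: eq_add)

lemma eq_rel: "p - q \<in> fn_rels D \<union> gha_rels f \<Longrightarrow> p \<doteq> q"
  using gha_ideal.rel[of "p - q" D f 1 1] by (simp add: gha_eq_def)

lemma fn_cong: "(\<And>z. z \<in> D \<Longrightarrow> g z = h z) \<Longrightarrow> fn g \<doteq> fn h"
  by (rule eq_rel) (unfold fn_rels_def, blast)

lemma fn_const: "fn (\<lambda>_. c) \<doteq> scal c"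
  by (rule eq_rel) (auto simp: fn_rels_def)

lemma fn_add: "fn (\<lambda>z. g z + h z) \<doteq> fn g + fn h"
  by (rule eq_rel) (auto simp: fn_rels_def)

lemma fn_mult: "fn (\<lambda>z. g z * h z) \<doteq> fn g * fn h"
  by (rule eq_rel) (auto simp: fn_rels_def)

lemma fn_diff: "fn (\<lambda>z. g z - h z) \<doteq> fn g - fn h"
proof -
  have "fn (\<lambda>z. (g z - h z) + h z) \<doteq> fn (\<lambda>z. g z - h z) + fn h" by (rule fn_add)
  then have "fn g - fn h \<doteq> fn (\<lambda>z. g z - h z) + fn h - fn h" by (intro eq_diff) auto
  then show ?thesis using eq_sym by simp
qed

lemma fn_zero: "fn (\<lambda>_. 0) \<doteq> 0"
  using fn_const[of 0] by (simp add: scal_def)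

lemma fn_one: "fn (\<lambda>_. 1) \<doteq> 1"
  using fn_const[of 1] by (simp add: scal_def)

lemma fn_commute: "fn g * fn h \<doteq> fn h * fn g"
proof -
  have "fn g * fn h \<doteq> fn (\<lambda>z. g z * h z)" by (rule eq_sym[OF fn_mult])
  also have "\<dots> \<doteq> fn (\<lambda>z. h z * g z)" by (rule fn_cong) simp
  also have "\<dots> \<doteq> fn h * fn g" by (rule fn_mult)
  finally show ?thesis .
qed

lemma ann_fn: "ann * fn g \<doteq> fn (\<lambda>z. g (f z)) * ann"
  by (rule eq_rel) (auto simp: gha_rels_def)

lemma fn_cre: "fn g * cre \<doteq> cre * fn (\<lambda>z. g (f z))"
  by (rule eq_rel) (auto simp: gha_rels_def)

lemma ann_cre: "ann * cre \<doteq> num + fn f - ham"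
proof -
  have "ann * cre - num \<doteq> fn f - ham" by (rule eq_rel) (auto simp: gha_rels_def)
  then have "ann * cre - num + num \<doteq> fn f - ham + num" by (rule eq_add) auto
  then show ?thesis by (simp add: algebra_simps)
qed

text \<open>
  The relation for \<open>a\<^sup>\<dagger>\<close> can be read from right to left because a function of \<open>H\<close> depends only on its
  values on \<open>D\<close>, where \<open>f\<close> is invertible.
\<close>

lemma cre_fn: "cre * fn g \<doteq> fn (\<lambda>z. g (finv z)) * cre"
proof -
  have "cre * fn g \<doteq> cre * fn (\<lambda>z. g (finv (f z)))"
    by (intro eq_mult fn_cong) (auto simp: finv_f)
  also have "\<dots> \<doteq> fn (\<lambda>z. g (finv z)) * cre"
    by (rule eq_sym[OF fn_cre])
  finally show ?thesis .
qed

lemma cre_power_fn: "cre ^ n * fn g \<doteq> fn (\<lambda>z. g ((finv ^^ n) z)) * cre ^ n"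
proof (induction n arbitrary: g)
  case 0
  show ?case by simp
next
  case (Suc n)
  have "cre ^ Suc n * fn g = cre ^ n * (cre * fn g)" by (simp only: power_Suc2 mult.assoc)
  also have "\<dots> \<doteq> cre ^ n * (fn (\<lambda>z. g (finv z)) * cre)" by (intro eq_mult cre_fn) auto
  also have "\<dots> = (cre ^ n * fn (\<lambda>z. g (finv z))) * cre" by (simp add: mult.assoc)
  also have "\<dots> \<doteq> (fn (\<lambda>z. g (finv ((finv ^^ n) z))) * cre ^ n) * cre"
    by (intro eq_mult Suc.IH) auto
  also have "\<dots> = fn (\<lambda>z. g ((finv ^^ Suc n) z)) * cre ^ Suc n"
    by (simp add: power_Suc2 mult.assoc del: power_Suc)
  finally show ?case .
qed

text \<open>
  The shift by \<open>f\<close> caused by \<open>a\<close> is undone by \<open>a\<^sup>\<dagger>\<close>.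
\<close>

lemma num_fn: "num * fn g \<doteq> fn g * num"
proof -
  have "num * fn g = cre * (ann * fn g)" by (simp add: mult.assoc)
  also have "\<dots> \<doteq> cre * (fn (\<lambda>z. g (f z)) * ann)" by (intro eq_mult ann_fn) auto
  also have "\<dots> = (cre * fn (\<lambda>z. g (f z))) * ann" by (simp add: mult.assoc)
  also have "\<dots> \<doteq> (fn (\<lambda>z. g (f (finv z))) * cre) * ann" by (intro eq_mult cre_fn) auto
  also have "\<dots> \<doteq> (fn g * cre) * ann"
    by (intro eq_mult fn_cong) (auto simp: f_finv)
  also have "\<dots> = fn g * num" by (simp add: mult.assoc)
  finally show ?thesis .
qed

section \<open>The expansion in degenerate falling factorials\<close>

text \<open>
  The commutator relation is built to make this hold: moving \<open>N\<close> past \<open>a\<close> costs \<open>f(H) - H\<close>, which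
  is also what moving \<open>H\<close> past \<open>a\<close> costs.
\<close>

lemma casimir_ann: "(num - ham) * ann \<doteq> ann * (num - ham)"
proof -
  have ann_ham: "ann * ham \<doteq> fn f * ann"
    using ann_fn[of "\<lambda>z. z"] by (simp add: ham_def)
  have "ann * (num - ham) = (ann * cre) * ann - ann * ham" by (simp add: algebra_simps)
  also have "\<dots> \<doteq> (num + fn f - ham) * ann - fn f * ann"
    by (rule eq_diff[OF eq_mult[OF ann_cre eq_refl] ann_ham])
  also have "\<dots> = (num - ham) * ann" by (simp add: algebra_simps)
  finally show ?thesis by (rule eq_sym)
qed

lemma casimir_ann_power: "(num - ham) * ann ^ n \<doteq> ann ^ n * (num - ham)"
proof (induction n)
  case 0
  show ?case by simp
next
  case (Suc n)
  have "(num - ham) * ann ^ Suc n = ((num - ham) * ann) * ann ^ n" by (simp add: mult.assoc)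
  also have "\<dots> \<doteq> (ann * (num - ham)) * ann ^ n" by (intro eq_mult casimir_ann) auto
  also have "\<dots> = ann * ((num - ham) * ann ^ n)" by (simp add: mult.assoc)
  also have "\<dots> \<doteq> ann * (ann ^ n * (num - ham))" by (intro eq_mult Suc.IH) auto
  also have "\<dots> = ann ^ Suc n * (num - ham)" by (simp add: mult.assoc)
  finally show ?case .
qed

text \<open>
  The number operator in the middle of \<open>(a\<^sup>\<dagger>)\<^sup>n N a\<^sup>n\<close> is split as \<open>(N - H) + H\<close>, and the two parts leave
  in opposite directions. The term \<open>f\<^sup>-\<^sup>n(H)\<close> in \<open>(n)\<^sub>f(H)\<close> is what
  becomes of \<open>H\<close> on its way through \<open>(a\<^sup>\<dagger>)\<^sup>n\<close>.
\<close>

lemma normal_power_Suc: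
  "cre ^ Suc n * ann ^ Suc n \<doteq>
     (cre ^ n * ann ^ n) * (num - ham) + fn (finv ^^ n) * (cre ^ n * ann ^ n)"
proof -
  have cre_ham: "cre ^ n * ham \<doteq> fn (finv ^^ n) * cre ^ n"
    using cre_power_fn[of n "\<lambda>z. z"] by (simp add: ham_def)
  have "cre ^ Suc n * ann ^ Suc n = cre ^ n * num * ann ^ n"
    by (simp only: power_Suc2[of cre] power_Suc[of ann] mult.assoc)
  also have "\<dots> = cre ^ n * ((num - ham) * ann ^ n) + (cre ^ n * ham) * ann ^ n"
    by (simp add: algebra_simps)
  also have "\<dots> \<doteq> cre ^ n * (ann ^ n * (num - ham)) + (fn (finv ^^ n) * cre ^ n) * ann ^ n"
    by (rule eq_add[OF eq_mult[OF eq_refl casimir_ann_power] eq_mult[OF cre_ham eq_refl]])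
  also have "\<dots> = (cre ^ n * ann ^ n) * (num - ham) + fn (finv ^^ n) * (cre ^ n * ann ^ n)"
    by (simp add: mult.assoc)
  finally show ?thesis .
qed

lemma deg_falling_fn: "deg_falling lam num k * fn g \<doteq> fn g * deg_falling lam num k"
proof (induction k)
  case 0
  show ?case by simp
next
  case (Suc k)
  define c where "c = complex_of_nat k * complex_of_real lam"
  have "scal c * fn g \<doteq> fn (\<lambda>_. c) * fn g" by (intro eq_mult eq_sym[OF fn_const]) auto
  also have "\<dots> \<doteq> fn g * fn (\<lambda>_. c)" by (rule fn_commute)
  also have "\<dots> \<doteq> fn g * scal c" by (intro eq_mult fn_const) auto
  finally have "num * fn g - scal c * fn g \<doteq> fn g * num - fn g * scal c"
    by (intro eq_diff num_fn)
  then have *: "(num - scal c) * fn g \<doteq> fn g * (num - scal c)" by (simp add: algebra_simps)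
  have "deg_falling lam num (Suc k) * fn g = deg_falling lam num k * ((num - scal c) * fn g)"
    by (simp add: c_def mult.assoc)
  also have "\<dots> \<doteq> deg_falling lam num k * (fn g * (num - scal c))" by (intro eq_mult *) auto
  also have "\<dots> = (deg_falling lam num k * fn g) * (num - scal c)" by (simp add: mult.assoc)
  also have "\<dots> \<doteq> (fn g * deg_falling lam num k) * (num - scal c)"
    by (intro eq_mult Suc.IH) auto
  also have "\<dots> = fn g * deg_falling lam num (Suc k)" by (simp add: c_def mult.assoc)
  finally show ?case .
qed

text \<open>
  One term of the expansion under the recursion \<open>normal_power_Suc\<close>, with \<open>h = f\<^sup>-\<^sup>n\<close>. The factor
  \<open>N - H\<close> is written as \<open>(N - k\<lambda>) + (k\<lambda> - H)\<close>; the first part extends the falling factorial, the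
  second is a function of \<open>H\<close> and joins the coefficient.
\<close>

lemma deg_falling_step:
  "fn s * deg_falling lam num k * (num - ham) + fn h * (fn s * deg_falling lam num k) \<doteq>
     fn s * deg_falling lam num (Suc k)
     + fn (\<lambda>z. (of_nat k * of_real lam - (z - h z)) * s z) * deg_falling lam num k"
proof -
  define c where "c = complex_of_nat k * complex_of_real lam"
  let ?P = "deg_falling lam num k"
  let ?u = "\<lambda>z. c - (z - h z)"
  have P: "?P * (scal c - ham) \<doteq> (fn (\<lambda>_. c) - ham) * ?P"
  proof -
    have "?P * (scal c - ham) \<doteq> ?P * (fn (\<lambda>_. c) - ham)"
      by (intro eq_mult eq_diff eq_sym[OF fn_const]) auto
    also have "\<dots> = ?P * fn (\<lambda>_. c) - ?P * ham" by (simp add: algebra_simps)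
    also have "\<dots> \<doteq> fn (\<lambda>_. c) * ?P - ham * ?P"
      unfolding ham_def by (intro eq_diff deg_falling_fn)
    also have "\<dots> = (fn (\<lambda>_. c) - ham) * ?P" by (simp add: algebra_simps)
    finally show ?thesis .
  qed
  have U: "fn (\<lambda>_. c) - ham + fn h \<doteq> fn ?u"
  proof -
    have "fn ?u \<doteq> fn (\<lambda>_. c) - fn (\<lambda>z. z - h z)" by (rule fn_diff)
    also have "\<dots> \<doteq> fn (\<lambda>_. c) - (ham - fn h)"
      unfolding ham_def by (intro eq_diff fn_diff) auto
    also have "\<dots> = fn (\<lambda>_. c) - ham + fn h" by simp
    finally show ?thesis by (rule eq_sym)
  qed
  have "fn s * ?P * (num - ham) + fn h * (fn s * ?P)
      = fn s * deg_falling lam num (Suc k) + fn s * (?P * (scal c - ham)) + (fn h * fn s) * ?P"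
    by (simp add: c_def algebra_simps)
  also have "\<dots> \<doteq> fn s * deg_falling lam num (Suc k) + fn s * ((fn (\<lambda>_. c) - ham) * ?P)
      + (fn s * fn h) * ?P"
    by (intro eq_add eq_mult P fn_commute) auto
  also have "\<dots> = fn s * deg_falling lam num (Suc k) + (fn s * (fn (\<lambda>_. c) - ham + fn h)) * ?P"
    by (simp add: algebra_simps)
  also have "\<dots> \<doteq> fn s * deg_falling lam num (Suc k) + (fn s * fn ?u) * ?P"
    by (intro eq_add eq_mult U) auto
  also have "\<dots> \<doteq> fn s * deg_falling lam num (Suc k) + (fn ?u * fn s) * ?P"
    by (intro eq_add eq_mult fn_commute) auto
  also have "\<dots> \<doteq> fn s * deg_falling lam num (Suc k) + fn (\<lambda>z. ?u z * s z) * ?P"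
    by (intro eq_add eq_mult eq_sym[OF fn_mult]) auto
  finally show ?thesis by (simp add: c_def)
qed

text \<open>
  The solution of the claimed recurrence, made zero off \<open>D\<close> because the Stirling operators
  are normalised in this way.
\<close>

primrec coef :: "real \<Rightarrow> nat \<Rightarrow> int \<Rightarrow> complex \<Rightarrow> complex" where
  "coef lam 0 k z = (if k = 0 \<and> z \<in> D then 1 else 0)"
| "coef lam (Suc n) k z =
     (if z \<in> D then coef lam n (k - 1) z
        + (of_int k * of_real lam - f_num D f (int n) z) * coef lam n k z else 0)"

lemma coef_outside: "k < 0 \<or> k > int n \<Longrightarrow> coef lam n k = (\<lambda>_. 0)"
  by (induction n arbitrary: k) (auto simp: fun_eq_iff)

lemma coef_off_domain: "z \<notin> D \<Longrightarrow> coef lam n k z = 0"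
  by (cases n) auto

lemma f_num_nat: "f_num D f (int n) z = z - (finv ^^ n) z"
  by (cases "n = 0") (simp_all add: f_num_def comp_pow_def)

lemma coef_expansion:
  "cre ^ n * ann ^ n \<doteq> (\<Sum>k=0..n. fn (coef lam n (int k)) * deg_falling lam num k)"
proof (induction n)
  case 0
  have "1 \<doteq> fn (\<lambda>_. 1)" by (rule eq_sym[OF fn_one])
  also have "\<dots> \<doteq> fn (coef lam 0 0)" by (rule fn_cong) simp
  finally show ?case by (simp del: coef.simps)
next
  case (Suc n)
  let ?P = "deg_falling lam num"
  let ?s = "\<lambda>k. coef lam n (int k)"
  let ?g = "\<lambda>k z. (of_nat k * of_real lam - (z - (finv ^^ n) z)) * ?s k z"
  let ?h = "\<lambda>k. coef lam n (int k - 1)"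
  \<comment> \<open>Both parts are sums up to \<open>n + 1\<close>, since the coefficients with index \<open>-1\<close> and \<open>n + 1\<close> vanish.\<close>
  have up: "(\<Sum>k=0..n. fn (?s k) * ?P (Suc k)) \<doteq> (\<Sum>k=0..Suc n. fn (?h k) * ?P k)"
  proof -
    have "fn (?h 0) \<doteq> 0"
      using fn_zero coef_outside[of "-1" n] by simp
    then have "fn (?h 0) * ?P 0 \<doteq> 0 * ?P 0" by (intro eq_mult) auto
    then have "0 \<doteq> fn (?h 0) * ?P 0" by (simp add: eq_sym)
    then have "0 + (\<Sum>k=0..n. fn (?s k) * ?P (Suc k)) \<doteq>
        fn (?h 0) * ?P 0 + (\<Sum>k=0..n. fn (?s k) * ?P (Suc k))"
      by (intro eq_add) auto
    also have "\<dots> = (\<Sum>k=0..Suc n. fn (?h k) * ?P k)"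
      by (subst sum.atLeast0_atMost_Suc_shift) simp
    finally show ?thesis by simp
  qed
  have top: "(\<Sum>k=0..n. fn (?g k) * ?P k) \<doteq> (\<Sum>k=0..Suc n. fn (?g k) * ?P k)"
  proof -
    have "?g (Suc n) = (\<lambda>_. 0)" using coef_outside[of "int (Suc n)" n] by (simp add: fun_eq_iff)
    then have "fn (?g (Suc n)) \<doteq> 0" using fn_zero by simp
    then have "fn (?g (Suc n)) * ?P (Suc n) \<doteq> 0 * ?P (Suc n)" by (rule eq_mult) auto
    then have "0 \<doteq> fn (?g (Suc n)) * ?P (Suc n)" by (simp only: mult_zero_left eq_sym)
    then have "(\<Sum>k=0..n. fn (?g k) * ?P k) + 0 \<doteq>
        (\<Sum>k=0..n. fn (?g k) * ?P k) + fn (?g (Suc n)) * ?P (Suc n)"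
      by (intro eq_add) auto
    then show ?thesis by simp
  qed
  have "cre ^ Suc n * ann ^ Suc n \<doteq>
     (cre ^ n * ann ^ n) * (num - ham) + fn (finv ^^ n) * (cre ^ n * ann ^ n)"
    by (rule normal_power_Suc)
  also have "\<dots> \<doteq> (\<Sum>k=0..n. fn (?s k) * ?P k) * (num - ham)
      + fn (finv ^^ n) * (\<Sum>k=0..n. fn (?s k) * ?P k)"
    by (intro eq_add eq_mult Suc.IH) auto
  also have "\<dots> = (\<Sum>k=0..n. fn (?s k) * ?P k * (num - ham) + fn (finv ^^ n) * (fn (?s k) * ?P k))"
    by (simp only: sum_distrib_left sum_distrib_right sum.distrib)
  also have "\<dots> \<doteq> (\<Sum>k=0..n. fn (?s k) * ?P (Suc k) + fn (?g k) * ?P k)"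
    by (intro eq_sum deg_falling_step)
  also have "\<dots> = (\<Sum>k=0..n. fn (?s k) * ?P (Suc k)) + (\<Sum>k=0..n. fn (?g k) * ?P k)"
    by (rule sum.distrib)
  also have "\<dots> \<doteq> (\<Sum>k=0..Suc n. fn (?h k) * ?P k) + (\<Sum>k=0..Suc n. fn (?g k) * ?P k)"
    by (intro eq_add up top)
  also have "\<dots> = (\<Sum>k=0..Suc n. (fn (?h k) + fn (?g k)) * ?P k)"
    by (simp only: sum.distrib distrib_right)
  also have "\<dots> \<doteq> (\<Sum>k=0..Suc n. fn (coef lam (Suc n) (int k)) * ?P k)"
  proof (intro eq_sum eq_mult)
    fix k
    have "fn (?h k) + fn (?g k) \<doteq> fn (\<lambda>z. ?h k z + ?g k z)" by (rule eq_sym[OF fn_add])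
    also have "\<dots> \<doteq> fn (coef lam (Suc n) (int k))"
      by (rule fn_cong) (simp add: f_num_nat)
    finally show "fn (?h k) + fn (?g k) \<doteq> fn (coef lam (Suc n) (int k))" .
  qed auto
  finally show ?case .
qed

section \<open>A separating family of representations\<close>

text \<open>
  With functions of \<open>H\<close> acting by multiplication, the rules for moving them past \<open>a\<close> and \<open>a\<^sup>\<dagger>\<close> suggest
  weighted composition operators with \<open>f\<close> and its inverse. With weight \<open>1\<close> for \<open>a\<close> and \<open>u\<close> for \<open>a\<^sup>\<dagger>\<close>,
  the products \<open>a\<^sup>\<dagger>a\<close> and \<open>aa\<^sup>\<dagger>\<close> are multiplication by \<open>u(z)\<close> and \<open>u(f(z))\<close>, so the commutator relation asks for
  \<open>u(f(z)) - u(z) = f(z) - z\<close>. The solutions \<open>u(z) = c + z\<close> are enough; \<open>c\<close> is the value of the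
  central element \<open>N - H\<close>. The functions are total here, but only their values on \<open>D\<close> matter.
\<close>

fun act :: "complex \<Rightarrow> letter \<Rightarrow> (complex \<Rightarrow> complex) \<Rightarrow> complex \<Rightarrow> complex" where
  "act c Ann \<phi> z = \<phi> (f z)"
| "act c Cre \<phi> z = (c + z) * \<phi> (finv z)"
| "act c (Fn g) \<phi> z = g z * \<phi> z"

definition act_word :: "complex \<Rightarrow> word \<Rightarrow> (complex \<Rightarrow> complex) \<Rightarrow> complex \<Rightarrow> complex" where
  "act_word c w \<phi> = foldr (act c) (letters w) \<phi>"

definition rep :: "complex \<Rightarrow> free_alg \<Rightarrow> (complex \<Rightarrow> complex) \<Rightarrow> complex \<Rightarrow> complex" where
  "rep c p \<phi> z = (\<Sum>w\<in>Poly_Mapping.keys p. Poly_Mapping.lookup p w * act_word c w \<phi> z)"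

lemma act_word_add: "act_word c (u + v) \<phi> = act_word c u (act_word c v \<phi>)"
  by (simp add: act_word_def plus_word_def)

lemma act_lin:
  "act c l (\<lambda>z. \<Sum>i\<in>A. b i * \<phi> i z) z = (\<Sum>i\<in>A. b i * act c l (\<phi> i) z)"
  by (cases l) (auto simp: sum_distrib_left intro!: sum.cong)

lemma act_word_lin:
  "act_word c w (\<lambda>z. \<Sum>i\<in>A. b i * \<phi> i z) = (\<lambda>z. \<Sum>i\<in>A. b i * act_word c w (\<phi> i) z)"
proof -
  have "foldr (act c) ls (\<lambda>z. \<Sum>i\<in>A. b i * \<phi> i z)
      = (\<lambda>z. \<Sum>i\<in>A. b i * foldr (act c) ls (\<phi> i) z)" for ls
    by (induction ls) (simp_all add: act_lin[abs_def])
  then show ?thesis by (simp add: act_word_def)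
qed

lemma rep_zero [simp]: "rep c 0 \<phi> z = 0"
  by (simp add: rep_def)

lemma rep_add: "rep c (p + q) \<phi> z = rep c p \<phi> z + rep c q \<phi> z"
  unfolding rep_def by (rule setsum_keys_plus_distrib) (auto simp: distrib_right)

lemma rep_diff: "rep c (p - q) \<phi> z = rep c p \<phi> z - rep c q \<phi> z"
  using rep_add[of c "p - q" q \<phi> z] by simp

lemma rep_sum: "rep c (sum p A) \<phi> z = (\<Sum>i\<in>A. rep c (p i) \<phi> z)"
  by (induction A rule: infinite_finite_induct) (auto simp: rep_add)

lemma rep_single: "rep c (Poly_Mapping.single w b) \<phi> z = b * act_word c w \<phi> z"
  by (simp add: rep_def)

lemma (in -) update_eq_add_single:
  assumes "a \<notin> Poly_Mapping.keys p"
  shows "Poly_Mapping.update a b p = p + Poly_Mapping.single a b"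
  using assms
  by (intro poly_mapping_eqI)
    (auto simp: lookup_add lookup_single lookup_update in_keys_iff when_def)

lemma rep_mult: "rep c (p * q) \<phi> = rep c p (rep c q \<phi>)"
proof -
  have single: "rep c (Poly_Mapping.single u b * q) \<phi> z = b * act_word c u (rep c q \<phi>) z" for u b z
  proof (induction q rule: update_induct)
    case const
    show ?case
      using act_word_lin[of c u "\<lambda>_. 0" "\<lambda>_ _. 0" "{}::nat set"] by (simp add: rep_def)
  next
    case (update q v d)
    have lin: "act_word c u (\<lambda>z. g z + h z) z = act_word c u g z + act_word c u h z" for g h
      using act_word_lin[of c u "\<lambda>_. 1" "\<lambda>b. if b then g else h" "UNIV :: bool set"]
      by (simp add: UNIV_bool add.commute)
    have sc: "act_word c u (\<lambda>z. d * g z) z = d * act_word c u g z" for g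
      using act_word_lin[of c u "\<lambda>_. d" "\<lambda>_. g" "{()}"] by simp
    show ?case
      using update
      by (simp add: update_eq_add_single distrib_left rep_add mult_single rep_single
          act_word_add fun_eq_iff lin sc algebra_simps)
  qed
  show ?thesis
  proof (induction p rule: update_induct)
    case const
    show ?case by (simp add: fun_eq_iff)
  next
    case (update p u b)
    then show ?case
      by (simp add: update_eq_add_single distrib_right fun_eq_iff rep_add single rep_single)
  qed
qed

lemma rep_letters [simp]:
  "rep c ann \<phi> = (\<lambda>z. \<phi> (f z))"
  "rep c cre \<phi> = (\<lambda>z. (c + z) * \<phi> (finv z))"
  "rep c (fn g) \<phi> = (\<lambda>z. g z * \<phi> z)"
  "rep c (scal b) \<phi> = (\<lambda>z. b * \<phi> z)"
  "rep c 1 \<phi> = \<phi>"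
  by (auto simp: fun_eq_iff ann_def cre_def fn_def gen_def scal_def rep_single act_word_def
      zero_word_def rep_single simp flip: single_one)

text \<open>
  \<open>D\<close> is mapped to itself by \<open>f\<close> and its inverse, so the restriction to \<open>D\<close> is a quotient module. The
  defining relations hold only there: off \<open>D\<close>, \<open>finv\<close> does not invert \<open>f\<close>.
\<close>

lemma rep_cong_on:
  assumes "\<And>z. z \<in> D \<Longrightarrow> \<phi> z = \<psi> z" and "z \<in> D"
  shows "rep c p \<phi> z = rep c p \<psi> z"
proof -
  have "foldr (act c) ls \<phi> z = foldr (act c) ls \<psi> z" if "z \<in> D" for ls z
    using that
  proof (induction ls arbitrary: z)
    case Nil
    then show ?case using assms(1) by simp
  next
    case (Cons l ls)
    then show ?case by (cases l) (auto simp: f_in finv_in)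
  qed
  then show ?thesis using assms(2) by (simp add: rep_def act_word_def)
qed

text \<open>
  Each relation acts as zero on \<open>D\<close>; factors on its left see only those values, by
  \<open>rep_cong_on\<close>.
\<close>

lemma rep_ideal: "p \<in> gha_ideal D f \<Longrightarrow> z \<in> D \<Longrightarrow> rep c p \<phi> z = 0"
proof (induction arbitrary: z \<phi> rule: gha_ideal.induct)
  case zero
  show ?case by simp
next
  case (rel r x y)
  have r: "rep c r \<psi> w = 0" if "w \<in> D" for \<psi> w
    using rel(1) that
    by (auto simp: fn_rels_def gha_rels_def rep_diff rep_add rep_mult ham_def f_finv finv_f f_in finv_in)
      (simp_all add: algebra_simps)
  have "rep c (x * r * y) \<phi> z = rep c x (rep c r (rep c y \<phi>)) z" by (simp add: rep_mult)
  also have "\<dots> = rep c x (rep c 0 \<phi>) z" using rel(2) r by (intro rep_cong_on) auto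
  also have "\<dots> = rep c (x * 0) \<phi> z" by (simp only: rep_mult)
  finally show ?case by simp
next
  case (add p q)
  then show ?case by (simp add: rep_add)
qed

lemma rep_eq: "p \<doteq> q \<Longrightarrow> z \<in> D \<Longrightarrow> rep c p \<phi> z = rep c q \<phi> z"
  using rep_ideal[of "p - q" z c \<phi>] by (simp add: gha_eq_def rep_diff)

lemma rep_deg_falling:
  "z \<in> D \<Longrightarrow> rep c (deg_falling lam num k) \<phi> z
     = (\<Prod>i<k. c + z - of_nat i * of_real lam) * \<phi> z"
proof (induction k arbitrary: \<phi>)
  case 0
  show ?case by simp
next
  case (Suc k)
  then show ?case by (simp add: rep_mult rep_diff f_finv algebra_simps)
qed

section \<open>Uniqueness of the coefficients\<close>

text \<open>
  At \<open>x = j\<lambda>\<close> the falling factorials of index greater than \<open>j\<close> vanish and the one of index \<open>j\<close> does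
  not, because \<open>\<lambda>\<close> is nonzero. The system of equations at \<open>x = 0, \<lambda>, 2\<lambda>, \<dots>\<close> is therefore triangular.
\<close>

lemma (in -) falling_coeffs_unique:
  fixes s t :: "nat \<Rightarrow> complex" and lam :: real
  assumes "lam \<noteq> 0"
    and eq: "\<And>x. (\<Sum>k=0..n. s k * (\<Prod>i<k. x - of_nat i * of_real lam))
                = (\<Sum>k=0..n. t k * (\<Prod>i<k. x - of_nat i * of_real lam))"
    and "j \<le> n"
  shows "s j = t j"
  using \<open>j \<le> n\<close>
proof (induction j rule: less_induct)
  case (less j)
  let ?F = "\<lambda>k. \<Prod>i<k. of_nat j * complex_of_real lam - of_nat i * of_real lam"
  have "0 = (\<Sum>k=0..n. (s k - t k) * ?F k)"
    using eq[of "of_nat j * of_real lam"] by (simp add: sum_subtractf left_diff_distrib)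
  also have "\<dots> = (\<Sum>k\<in>{j}. (s k - t k) * ?F k)"
  proof (rule sum.mono_neutral_right)
    show "\<forall>k\<in>{0..n} - {j}. (s k - t k) * ?F k = 0"
    proof
      fix k assume k: "k \<in> {0..n} - {j}"
      show "(s k - t k) * ?F k = 0"
      proof (cases "k < j")
        case True
        then show ?thesis using less k by auto
      next
        case False
        then have "j < k" using k by auto
        then have "?F k = 0" by (intro prod_zero) auto
        then show ?thesis by simp
      qed
    qed
  qed (use less in auto)
  finally have "(s j - t j) * ?F j = 0" by simp
  moreover have "?F j \<noteq> 0"
    using \<open>lam \<noteq> 0\<close> by (auto simp flip: left_diff_distrib)
  ultimately show ?case by simp
qed

text \<open>
  Apply both sides to the constant function \<open>1\<close> in the representation with parameter \<open>c = x - z\<close> and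
  evaluate at \<open>z\<close>: the element \<open>N\<close> becomes the arbitrary number \<open>x\<close>.
\<close>

lemma expansion_unique:
  assumes "lam \<noteq> 0"
    and eq: "(\<Sum>k=0..n. fn (s k) * deg_falling lam num k)
           \<doteq> (\<Sum>k=0..n. fn (t k) * deg_falling lam num k)"
    and "k \<le> n" and z: "z \<in> D"
  shows "s k z = t k z"
proof (rule falling_coeffs_unique[where lam = lam and n = n and s = "\<lambda>k. s k z" and t = "\<lambda>k. t k z"])
  fix x
  show "(\<Sum>k=0..n. s k z * (\<Prod>i<k. x - of_nat i * of_real lam))
      = (\<Sum>k=0..n. t k z * (\<Prod>i<k. x - of_nat i * of_real lam))"
    using rep_eq[OF eq z, of "x - z" "\<lambda>_. 1"] z
    by (simp add: rep_sum rep_mult rep_deg_falling)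
qed (use assms in auto)

lemma deg_stirling1_eq_coef:
  assumes "lam \<noteq> 0"
  shows "deg_stirling1 D f lam n = coef lam n"
  unfolding deg_stirling1_def
proof (rule the_equality)
  show "cre ^ n * ann ^ n \<doteq> (\<Sum>k=0..n. fn (coef lam n (int k)) * deg_falling lam num k) \<and>
     (\<forall>k. k < 0 \<or> k > int n \<longrightarrow> coef lam n k = (\<lambda>_. 0)) \<and>
     (\<forall>k. \<forall>z. z \<notin> D \<longrightarrow> coef lam n k z = 0)"
    using coef_expansion coef_outside coef_off_domain by blast
next
  fix S :: "int \<Rightarrow> complex \<Rightarrow> complex"
  assume S: "cre ^ n * ann ^ n \<doteq> (\<Sum>k=0..n. fn (S (int k)) * deg_falling lam num k) \<and>
     (\<forall>k. k < 0 \<or> k > int n \<longrightarrow> S k = (\<lambda>_. 0)) \<and>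
     (\<forall>k. \<forall>z. z \<notin> D \<longrightarrow> S k z = 0)"
  have eq: "(\<Sum>k=0..n. fn (S (int k)) * deg_falling lam num k)
      \<doteq> (\<Sum>k=0..n. fn (coef lam n (int k)) * deg_falling lam num k)"
    using S coef_expansion eq_sym eq_trans by blast
  show "S = coef lam n"
  proof (intro ext)
    fix k z
    consider "k < 0 \<or> k > int n" | "z \<notin> D" | "z \<in> D" "0 \<le> k" "k \<le> int n" by linarith
    then show "S k z = coef lam n k z"
    proof cases
      case 1
      then have "S k = (\<lambda>_. 0)" using S by blast
      then show ?thesis using 1 by (simp add: coef_outside)
    next
      case 2
      then show ?thesis using S by (simp add: coef_off_domain)
    next
      case 3
      then show ?thesis using expansion_unique[OF assms eq, of "nat k" z] by simp
    qed
  qed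
qed

end

section \<open>The recurrence\<close>

theorem theorem3p2:
  fixes D :: "complex set" and f :: "complex \<Rightarrow> complex" and lam :: real
    and n :: nat and k :: int
  assumes "D \<subseteq> \<real>"
    and "f analytic_on D"
    and "bij_betw f D D"
    and "lam \<noteq> 0"
    and "0 \<le> k" and "k \<le> int n"
  shows "\<forall>z\<in>D. deg_stirling1 D f lam (n + 1) k z =
           deg_stirling1 D f lam n (k - 1) z
           + (of_int k * of_real lam - f_num D f (int n) z) * deg_stirling1 D f lam n k z"
proof -
  interpret gha D f by unfold_locales (rule assms(3))
  show ?thesis by (simp add: deg_stirling1_eq_coef[OF assms(4)])
qed

end
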